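(* Let $\phi_{\mathbb{Z}[i]}$ be the minimal Euclidean function on $\mathbb{Z}[i]$. For every integer $k\ge1$, \[|\phi_{\mathbb{Z}[i]}^{-1}(2k)|=14\cdot 4^k-14\cdot 2^k+4\quad\text{and}\quad |\phi_{\mathbb{Z}[i]}^{-1}(2k+1)|=28\cdot 4^k-20\cdot 2^k+4.\]
   Context: For $M\subseteq\mathbb{Z}[i]$ and $\beta\in\mathbb{Z}[i]$, write $M\twoheadrightarrow \mathbb{Z}[i]/\beta$ if every residue class of $\mathbb{Z}[i]/(\beta)$ has a representative in $M$. The Motzkin sets are $A_{\mathbb{Z}[i],0}=\{0,\pm1,\pm i\}$ and, for $j\ge1$, $A_{\mathbb{Z}[i],j}=A_{\mathbb{Z}[i],j-1}\cup\{\beta: A_{\mathbb{Z}[i],j-1}\twoheadrightarrow\mathbb{Z}[i]/\beta\}$. The minimal Euclidean function $\phi_{\mathbb{Z}[i]}:\mathbb{Z}[i]\setminus 0\to\mathbb{N}$ is $\phi_{\mathbb{Z}[i]}(a)=j$ where $j$ is least with $a\in A_{\mathbb{Z}[i],j}$. *)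

theory Defs
  imports Complex_Main
begin

definition gauss_ints :: "complex set" where
  "gauss_ints = {z. Re z \<in> \<int> \<and> Im z \<in> \<int>}"

definition residue_class :: "complex \<Rightarrow> complex \<Rightarrow> complex set" where
  "residue_class \<beta> x = {x + q * \<beta> |q. q \<in> gauss_ints}"

definition represents_all_classes :: "complex set \<Rightarrow> complex \<Rightarrow> bool" where
  "represents_all_classes M \<beta> \<longleftrightarrow>
     (\<forall>x\<in>gauss_ints. \<exists>m\<in>M. m \<in> residue_class \<beta> x)"

primrec motzkin :: "nat \<Rightarrow> complex set" where
  "motzkin 0 = {0, 1, -1, \<i>, -\<i>}"
| "motzkin (Suc j) = motzkin j \<union> {\<beta> \<in> gauss_ints. represents_all_classes (motzkin j) \<beta>}"

text \<open>
  The mathematical domain of the minimal Euclidean function is the set of nonzero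
  Gaussian integers; values outside it are irrelevant, so preimages have to be
  intersected with that domain.
\<close>

definition min_euclid :: "complex \<Rightarrow> nat" where
  "min_euclid a = (LEAST j. a \<in> motzkin j)"

end

theory Submission
  imports Defs
begin

text \<open>
  The Motzkin set with index \<open>n\<close> consists of the products \<open>(1 + i)^e w\<close> where \<open>w\<close> is odd
  (not divisible by \<open>1 + i\<close>) and lies in the octagon with index \<open>n - e\<close>, together with \<open>0\<close>
  (\<open>oct_tower n\<close> below). Hence the elements with \<open>\<phi> = n \<ge> 1\<close> are as many as the odd
  points of the octagon with index \<open>n\<close>, which is a diamond without its four corners.

  Even moduli are reduced to smaller \<open>n\<close> by dividing everything by \<open>1 + i\<close>. An odd modulus \<open>\<beta>\<close>
  whose classes are all represented lies in the next octagon, as a single well-chosen class shows.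
  Conversely, if \<open>\<beta>\<close> is odd and lies in that octagon, take a representative \<open>z\<close> in the square
  spanned by \<open>\<beta>\<close> around \<open>0\<close>; if \<open>z\<close> is not in the Motzkin set, then it is even and so
  far from \<open>0\<close> that for some unit \<open>u\<close> the odd number \<open>z - u \<beta>\<close> is in the octagon.
\<close>

section \<open>Octagons and the tower sets\<close>

text \<open>Two factors 1 + i make 2i, which doubles all lengths; hence the widths 3 * 2^k at index
  2k and 4 * 2^k at index 2k + 1.\<close>

fun oct_width :: "nat \<Rightarrow> int" where
  "oct_width 0 = 3"
| "oct_width (Suc 0) = 4"
| "oct_width (Suc (Suc n)) = 2 * oct_width n"

definition octagon :: "nat \<Rightarrow> int \<Rightarrow> int \<Rightarrow> bool" where
  "octagon n a b \<longleftrightarrow> \<bar>a\<bar> \<le> oct_width n - 2 \<and> \<bar>b\<bar> \<le> oct_width n - 2 \<and>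
     \<bar>a\<bar> + \<bar>b\<bar> \<le> oct_width (Suc n) - 3"

text \<open>The pair \<open>a\<close>, \<open>b\<close> stands for a + bi, and the two halves are
  the coordinates of its quotient by 1 + i. The octagon at level 0 consists of 0 and the
  units.\<close>

primrec oct_tower :: "nat \<Rightarrow> int \<Rightarrow> int \<Rightarrow> bool" where
  "oct_tower 0 a b \<longleftrightarrow> octagon 0 a b"
| "oct_tower (Suc n) a b \<longleftrightarrow>
     (if even (a + b) then oct_tower n ((a + b) div 2) ((b - a) div 2) else octagon (Suc n) a b)"

text \<open>The added terms are the coordinates of (r + si)(a + bi).\<close>

definition tower_covers :: "nat \<Rightarrow> int \<Rightarrow> int \<Rightarrow> bool" where
  "tower_covers n a b \<longleftrightarrow>
     (\<forall>x y. \<exists>r s. oct_tower n (x + (r * a - s * b)) (y + (r * b + s * a)))"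

lemma oct_width_growth: "oct_width n < oct_width (Suc n) \<and> oct_width (Suc n) < 2 * oct_width n"
  by (induction n) auto

lemma oct_width_ge: "oct_width n \<ge> int n + 3"
proof (induction n)
  case (Suc n)
  then show ?case using oct_width_growth[of n] by simp
qed simp

lemma even_oct_width_Suc: "even (oct_width (Suc n))"
  by (cases n rule: oct_width.cases) auto

lemma octagon_sym:
  "octagon n (- a) b = octagon n a b" "octagon n a (- b) = octagon n a b"
  "octagon n a b = octagon n b a"
  by (auto simp: octagon_def)

lemma oct_tower_0: "oct_tower n 0 0"
  by (induction n) (auto simp: octagon_def)

text \<open>Multiplication by 1 + i turns the bound on the sum into bounds on the coordinates and
  vice versa, with one unit to spare each time.\<close>

lemma oct_tower_imp_octagon: "oct_tower n a b \<Longrightarrow> octagon n a b"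
proof (induction n arbitrary: a b)
  case (Suc n)
  show ?case
  proof (cases "even (a + b)")
    case True
    define c d where "c = (a + b) div 2" and "d = (b - a) div 2"
    have ab: "a = c - d" "b = c + d"
      using True unfolding c_def d_def by presburger+
    have "octagon n c d"
      using Suc True by (auto simp: c_def d_def)
    then show ?thesis
      unfolding octagon_def ab by auto
  qed (use Suc in auto)
qed auto

lemma oct_tower_odd:
  assumes "odd (a + b)"
  shows "oct_tower n a b \<longleftrightarrow> octagon n a b"
  using assms by (cases n) auto

lemma oct_tower_mult: "oct_tower (Suc n) (p - q) (p + q) \<longleftrightarrow> oct_tower n p q"
proof -
  have "(p - q + (p + q)) div 2 = p" "(p + q - (p - q)) div 2 = q" by presburger+
  then show ?thesis by simp
qed

text \<open>The added 1 uses up the spare unit left by multiplication by 1 + i, and the result is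
  odd, so that the octagon bounds suffice. This provides the odd representatives modulo an even
  number.\<close>

lemma oct_tower_mult_add_1:
  assumes "oct_tower n p q"
  shows "oct_tower (Suc n) (1 + (p - q)) (p + q)"
proof -
  have "octagon n p q" using assms by (rule oct_tower_imp_octagon)
  then have "octagon (Suc n) (1 + (p - q)) (p + q)"
    unfolding octagon_def by auto
  then show ?thesis by (subst oct_tower_odd) auto
qed

lemma gauss_factor:
  fixes a b :: int
  assumes "even (a + b)"
  obtains c d where "a = c - d" "b = c + d"
proof
  show "a = (a + b) div 2 - (b - a) div 2" "b = (a + b) div 2 + (b - a) div 2"
    using assms by presburger+
qed

lemma oct_tower_mono: "oct_tower n a b \<Longrightarrow> oct_tower (Suc n) a b"
proof (induction n arbitrary: a b)
  case 0
  show ?case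
  proof (cases "even (a + b)")
    case True
    then have "a = 0 \<and> b = 0" using 0 by (simp add: octagon_def) presburger
    then show ?thesis using oct_tower_0 by blast
  qed (use 0 in \<open>auto simp: octagon_def\<close>)
next
  case (Suc n)
  show ?case
  proof (cases "even (a + b)")
    case True
    then obtain c d where "a = c - d" "b = c + d" by (rule gauss_factor)
    then show ?thesis using Suc by (simp only: oct_tower_mult)
  next
    case False
    then have "octagon (Suc n) a b" using Suc by simp
    then have "octagon (Suc (Suc n)) a b"
      using oct_width_growth[of "Suc n"] oct_width_growth[of "Suc (Suc n)"]
      unfolding octagon_def by linarith
    then show ?thesis using False by simp
  qed
qed

text \<open>Guarantees that the minimum in \<open>min_euclid\<close> is attained. Division by 1 + i
  halves the norm, and an odd element lies in every sufficiently wide octagon.\<close>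

lemma oct_tower_exhausts: "\<exists>n. oct_tower n a b"
proof (induction "nat (a\<^sup>2 + b\<^sup>2)" arbitrary: a b rule: less_induct)
  case less
  show ?case
  proof (cases "even (a + b)")
    case True
    then obtain c d where ab: "a = c - d" "b = c + d" by (rule gauss_factor)
    show ?thesis
    proof (cases "c = 0 \<and> d = 0")
      case True
      then show ?thesis using ab oct_tower_0 by auto
    next
      case False
      have "a\<^sup>2 + b\<^sup>2 = 2 * (c\<^sup>2 + d\<^sup>2)"
        unfolding ab by (simp add: power2_eq_square algebra_simps)
      moreover have "c\<^sup>2 + d\<^sup>2 > 0"
        using False by (simp add: sum_power2_gt_zero_iff)
      ultimately have "nat (c\<^sup>2 + d\<^sup>2) < nat (a\<^sup>2 + b\<^sup>2)"
        by (subst nat_mono_iff) auto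
      then obtain n where "oct_tower n c d" using less by blast
      then show ?thesis unfolding ab using oct_tower_mult by blast
    qed
  next
    case False
    define n where "n = nat (\<bar>a\<bar> + \<bar>b\<bar>)"
    have "octagon n a b"
      using oct_width_ge[of n] oct_width_ge[of "Suc n"] unfolding octagon_def n_def by linarith
    then show ?thesis using False oct_tower_odd by blast
  qed
qed

section \<open>Moving an even point into the octagon by a unit multiple of the modulus\<close>

text \<open>The shape of this conclusion is dictated by the induction: division by \<open>1 + i\<close> exchanges the
  first two bounds and turns the third one into its contrapositive.\<close>

lemma not_oct_tower_large:
  assumes "\<not> oct_tower n a b" "p = max \<bar>a\<bar> \<bar>b\<bar>" "q = min \<bar>a\<bar> \<bar>b\<bar>"
  shows "p \<ge> oct_width (Suc n) - oct_width n
       \<and> p + q \<ge> 2 * oct_width n - oct_width (Suc n)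
       \<and> (p - q < 2 * oct_width n - oct_width (Suc n) \<longrightarrow> q \<ge> oct_width (Suc n) - oct_width n)"
  using assms
proof (induction n arbitrary: a b p q)
  case 0
  then have "2 \<le> \<bar>a\<bar> + \<bar>b\<bar>" by (simp add: octagon_def) linarith
  then show ?case using 0 by (simp add: max_def min_def)
next
  case (Suc n)
  show ?case
  proof (cases "even (a + b)")
    case True
    then obtain c d where ab: "a = c - d" "b = c + d" by (rule gauss_factor)
    have "\<not> oct_tower n c d" using Suc.prems(1) unfolding ab oct_tower_mult .
    note IH = Suc.IH[OF this refl refl]
    show ?thesis
      using IH unfolding Suc.prems(2,3) ab oct_width.simps by (auto simp: max_def min_def abs_if split: if_splits)
  next
    case False
    then have no: "\<not> octagon (Suc n) a b" using Suc.prems(1) by simp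
    \<comment> \<open>Parity sharpens the failure of the third bound by one: an odd sum cannot equal
      an even width minus 2.\<close>
    have "odd (\<bar>a\<bar> + \<bar>b\<bar>)" using False by simp
    then have "\<bar>a\<bar> + \<bar>b\<bar> \<noteq> oct_width (Suc (Suc n)) - 2"
      using even_oct_width_Suc[of "Suc n"] by presburger
    then show ?thesis
      using no oct_width_growth[of "Suc n"] Suc.prems(2,3) unfolding octagon_def by linarith
  qed
qed


text \<open>With z = p + qi and beta = a + bi, the two candidates z - beta and z + i beta are the
  shifts that do not increase the real part. The lower bounds on z are those of
  \<open>not_oct_tower_large\<close>.\<close>

lemma shift_into_octagon_sector:
  assumes "0 \<le> q" "q \<le> p" "0 \<le> a" "0 \<le> b" "odd (a + b)" "even (p + q)"
    and "octagon (Suc n) a b" "p \<le> oct_width n - 2" "p + q \<le> oct_width (Suc n) - 2"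
    and "p \<ge> oct_width (Suc n) - oct_width n" "p + q \<ge> 2 * oct_width n - oct_width (Suc n)"
    and "p - q < 2 * oct_width n - oct_width (Suc n) \<longrightarrow> q \<ge> oct_width (Suc n) - oct_width n"
  shows "octagon n (p - a) (q - b) \<or> octagon n (p - b) (q + a)"
proof -
  define W V where "W = oct_width n" and "V = oct_width (Suc n)"
  have WV: "W < V" "V < 2 * W" "even V"
    using oct_width_growth even_oct_width_Suc by (auto simp: W_def V_def)
  have ab: "a \<le> V - 2" "b \<le> V - 2" "a + b \<le> 2 * W - 3"
    using assms(3,4,7) by (auto simp: octagon_def W_def V_def)
  note x = assms(8-12)[folded W_def V_def]
  \<comment> \<open>In these boundary cases, excluded by parity, the third bound of the octagon
    could be missed by exactly one.\<close>
  have "a \<noteq> V - 2 \<or> b \<noteq> 0" "b \<noteq> V - 2 \<or> p \<noteq> a + q"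
    using assms(5,6) WV(3) by presburger+
  moreover have "a \<noteq> b" using assms(5) by auto
  ultimately show ?thesis
    unfolding octagon_def W_def[symmetric] V_def[symmetric]
    using WV(1,2) ab x assms(1-4) by (smt (verit))
qed

text \<open>The four points are z - u beta for u = 1, -1, -i, i.\<close>

definition shift_reaches :: "nat \<Rightarrow> int \<Rightarrow> int \<Rightarrow> int \<Rightarrow> int \<Rightarrow> bool" where
  "shift_reaches n p q a b \<longleftrightarrow> octagon n (p - a) (q - b) \<or> octagon n (p + a) (q + b) \<or>
     octagon n (p - b) (q + a) \<or> octagon n (p + b) (q - a)"

lemma shift_reaches_sym:
  "shift_reaches n (- p) q a b \<longleftrightarrow> shift_reaches n p q (- a) b"
  "shift_reaches n p (- q) a b \<longleftrightarrow> shift_reaches n p q a (- b)"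
  "shift_reaches n p q (- a) (- b) \<longleftrightarrow> shift_reaches n p q a b"
  "shift_reaches n p q (- b) a \<longleftrightarrow> shift_reaches n p q a b"
  "shift_reaches n q p a b \<longleftrightarrow> shift_reaches n p q b a"
  unfolding shift_reaches_def octagon_def by (smt (verit))+

text \<open>Reduction to the sector by symmetry: a unit factor of beta only permutes the four
  shifts, and a reflection of z can be transferred to beta, since octagons are invariant under
  it.\<close>

lemma shift_into_octagon:
  assumes "\<not> oct_tower n p q" "odd (a + b)" "even (p + q)" "octagon (Suc n) a b"
    and "\<bar>p\<bar> \<le> oct_width n - 2" "\<bar>q\<bar> \<le> oct_width n - 2"
    and "\<bar>p\<bar> + \<bar>q\<bar> \<le> oct_width (Suc n) - 2"
  shows "shift_reaches n p q a b"
proof -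
  note large = not_oct_tower_large[OF assms(1) refl refl]
  have sector: "shift_reaches n (max \<bar>p\<bar> \<bar>q\<bar>) (min \<bar>p\<bar> \<bar>q\<bar>) c d"
    if "0 \<le> c" "0 \<le> d" "odd (c + d)" "octagon (Suc n) c d" for c d
  proof -
    have "even (max \<bar>p\<bar> \<bar>q\<bar> + min \<bar>p\<bar> \<bar>q\<bar>)"
      using assms(3) by (auto simp: max_def min_def)
    moreover have "0 \<le> min \<bar>p\<bar> \<bar>q\<bar>" "min \<bar>p\<bar> \<bar>q\<bar> \<le> max \<bar>p\<bar> \<bar>q\<bar>"
      "max \<bar>p\<bar> \<bar>q\<bar> \<le> oct_width n - 2"
      "max \<bar>p\<bar> \<bar>q\<bar> + min \<bar>p\<bar> \<bar>q\<bar> \<le> oct_width (Suc n) - 2"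
      using assms(5-7) by linarith+
    ultimately show ?thesis
      using shift_into_octagon_sector[of "min \<bar>p\<bar> \<bar>q\<bar>" "max \<bar>p\<bar> \<bar>q\<bar>" c d n] that large
      unfolding shift_reaches_def by blast
  qed
  have quadrant: "shift_reaches n (max \<bar>p\<bar> \<bar>q\<bar>) (min \<bar>p\<bar> \<bar>q\<bar>) c d"
    if "odd (c + d)" "octagon (Suc n) c d" for c d
  proof (cases "0 \<le> c"; cases "0 \<le> d")
    assume "0 \<le> c" "0 \<le> d"
    then show ?thesis using sector that by blast
  next
    assume "0 \<le> c" "\<not> 0 \<le> d"
    then have "shift_reaches n (max \<bar>p\<bar> \<bar>q\<bar>) (min \<bar>p\<bar> \<bar>q\<bar>) (- d) c"
      using that by (intro sector) (auto simp: octagon_sym)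
    then show ?thesis by (simp only: shift_reaches_sym(4))
  next
    assume "\<not> 0 \<le> c" "0 \<le> d"
    then have "shift_reaches n (max \<bar>p\<bar> \<bar>q\<bar>) (min \<bar>p\<bar> \<bar>q\<bar>) d (- c)"
      using that by (intro sector) (auto simp: octagon_sym)
    then have "shift_reaches n (max \<bar>p\<bar> \<bar>q\<bar>) (min \<bar>p\<bar> \<bar>q\<bar>) (- (- c)) d"
      by (simp only: shift_reaches_sym(4))
    then show ?thesis by simp
  next
    assume "\<not> 0 \<le> c" "\<not> 0 \<le> d"
    then have "shift_reaches n (max \<bar>p\<bar> \<bar>q\<bar>) (min \<bar>p\<bar> \<bar>q\<bar>) (- c) (- d)"
      using that by (intro sector) (auto simp: octagon_sym)
    then show ?thesis by (simp only: shift_reaches_sym(3))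
  qed
  have ordered: "shift_reaches n \<bar>p\<bar> \<bar>q\<bar> c d" if "odd (c + d)" "octagon (Suc n) c d" for c d
  proof (cases "\<bar>q\<bar> \<le> \<bar>p\<bar>")
    case True
    then have "max \<bar>p\<bar> \<bar>q\<bar> = \<bar>p\<bar>" "min \<bar>p\<bar> \<bar>q\<bar> = \<bar>q\<bar>" by linarith+
    then show ?thesis using quadrant[OF that] by simp
  next
    case False
    have "shift_reaches n (max \<bar>p\<bar> \<bar>q\<bar>) (min \<bar>p\<bar> \<bar>q\<bar>) d c"
      using that by (intro quadrant) (auto simp: octagon_sym)
    moreover have "max \<bar>p\<bar> \<bar>q\<bar> = \<bar>q\<bar>" "min \<bar>p\<bar> \<bar>q\<bar> = \<bar>p\<bar>" using False by linarith+
    ultimately show ?thesis using shift_reaches_sym(5)[of n "\<bar>q\<bar>" "\<bar>p\<bar>" d c] by simp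
  qed
  define e f where "e = (if p < 0 then - a else a)" and "f = (if q < 0 then - b else b)"
  have "shift_reaches n \<bar>p\<bar> \<bar>q\<bar> e f"
    using assms(2,4) by (intro ordered) (auto simp: octagon_sym e_def f_def)
  then show ?thesis
    by (auto simp: shift_reaches_sym(1,2) e_def f_def abs_if split: if_splits)
qed

section \<open>Elements of the next tower set have all classes represented\<close>

lemma nearest_multiple:
  fixes m :: int
  assumes "m > 0"
  obtains r where "2 * \<bar>x + r * m\<bar> \<le> m"
proof
  \<comment> \<open>The quotient x / m rounded to a nearest integer.\<close>
  define t where "t = (2 * x + m) div (2 * m)"
  have "2 * x + m = t * (2 * m) + (2 * x + m) mod (2 * m)"
    unfolding t_def by (simp only: div_mult_mod_eq)
  moreover have "0 \<le> (2 * x + m) mod (2 * m)" "(2 * x + m) mod (2 * m) < 2 * m"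
    using assms by simp_all
  ultimately show "2 * \<bar>x + (- t) * m\<bar> \<le> m"
    by (auto simp: algebra_simps abs_if)
qed

lemma l1_rotate: "\<bar>a\<bar> + \<bar>b\<bar> = max \<bar>a + b\<bar> \<bar>a - b\<bar>" for a b :: int
  by (auto simp: max_def abs_if)

lemma sup_rotate: "2 * max \<bar>a\<bar> \<bar>b\<bar> = \<bar>a + b\<bar> + \<bar>a - b\<bar>" for a b :: int
  by (auto simp: max_def abs_if)

text \<open>The fundamental domain consisting of the \<open>z\<close> whose quotient by \<open>a + bi\<close> has
  both coordinates in \<open>[-1/2, 1/2]\<close>.\<close>

lemma reduced_representative:
  fixes a b x y :: int
  assumes "a \<noteq> 0 \<or> b \<noteq> 0"
  obtains r s X Y where "X = x + (r * a - s * b)" "Y = y + (r * b + s * a)"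
    "2 * \<bar>X\<bar> \<le> \<bar>a\<bar> + \<bar>b\<bar>" "2 * \<bar>Y\<bar> \<le> \<bar>a\<bar> + \<bar>b\<bar>" "\<bar>X\<bar> + \<bar>Y\<bar> \<le> max \<bar>a\<bar> \<bar>b\<bar>"
proof -
  define N where "N = a * a + b * b"
  have N: "N > 0" using assms sum_power2_gt_zero_iff[of a b] by (simp add: N_def power2_eq_square)
  obtain r where r: "2 * \<bar>(x * a + y * b) + r * N\<bar> \<le> N" using nearest_multiple[OF N] .
  obtain s where s: "2 * \<bar>(y * a - x * b) + s * N\<bar> \<le> N" using nearest_multiple[OF N] .
  define A B where "A = (x * a + y * b) + r * N" and "B = (y * a - x * b) + s * N"
  define X Y where "X = x + (r * a - s * b)" and "Y = y + (r * b + s * a)"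
  \<comment> \<open>A + Bi is X + Yi times the conjugate of a + bi. So N times each of X, Y, X + Y,
    X - Y is an integral combination of A and B, both at most N / 2 in absolute value.\<close>
  have bound: "2 * \<bar>Z\<bar> \<le> \<bar>k\<bar> + \<bar>l\<bar>" if "N * Z = k * A + l * B" for Z k l
  proof -
    have "N * (2 * \<bar>Z\<bar>) = 2 * \<bar>N * Z\<bar>"
      using N by (simp add: abs_mult)
    also have "\<dots> = 2 * \<bar>k * A + l * B\<bar>" by (simp only: that)
    also have "\<dots> \<le> \<bar>k\<bar> * (2 * \<bar>A\<bar>) + \<bar>l\<bar> * (2 * \<bar>B\<bar>)"
      using abs_triangle_ineq[of "k * A" "l * B"] by (simp add: abs_mult)
    also have "\<dots> \<le> \<bar>k\<bar> * N + \<bar>l\<bar> * N"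
      using r s unfolding A_def B_def by (intro add_mono mult_left_mono) auto
    also have "\<dots> = N * (\<bar>k\<bar> + \<bar>l\<bar>)" by (simp add: algebra_simps)
    finally show ?thesis using N by simp
  qed
  have "2 * \<bar>X\<bar> \<le> \<bar>a\<bar> + \<bar>- b\<bar>" "2 * \<bar>Y\<bar> \<le> \<bar>b\<bar> + \<bar>a\<bar>"
    "2 * \<bar>X + Y\<bar> \<le> \<bar>a + b\<bar> + \<bar>a - b\<bar>" "2 * \<bar>X - Y\<bar> \<le> \<bar>a - b\<bar> + \<bar>- (a + b)\<bar>"
    by (rule bound, simp add: A_def B_def X_def Y_def N_def algebra_simps)+
  moreover have "\<bar>- (a + b)\<bar> = \<bar>a + b\<bar>" by (rule abs_minus_cancel)
  ultimately have "2 * \<bar>X\<bar> \<le> \<bar>a\<bar> + \<bar>b\<bar>" "2 * \<bar>Y\<bar> \<le> \<bar>a\<bar> + \<bar>b\<bar>"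
    "2 * \<bar>X + Y\<bar> \<le> \<bar>a + b\<bar> + \<bar>a - b\<bar>" "2 * \<bar>X - Y\<bar> \<le> \<bar>a + b\<bar> + \<bar>a - b\<bar>"
    by linarith+
  then show thesis
    using sup_rotate[of a b] l1_rotate[of X Y] by (intro that[OF X_def Y_def]) simp_all
qed

lemma tower_covers_odd:
  assumes "odd (a + b)" "octagon (Suc n) a b"
  shows "tower_covers n a b"
  unfolding tower_covers_def
proof (intro allI)
  fix x y
  have "a \<noteq> 0 \<or> b \<noteq> 0" using assms(1) by auto
  then obtain r s X Y where
    XY: "X = x + (r * a - s * b)" "Y = y + (r * b + s * a)"
    and red: "2 * \<bar>X\<bar> \<le> \<bar>a\<bar> + \<bar>b\<bar>" "2 * \<bar>Y\<bar> \<le> \<bar>a\<bar> + \<bar>b\<bar>" "\<bar>X\<bar> + \<bar>Y\<bar> \<le> max \<bar>a\<bar> \<bar>b\<bar>"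
    by (rule reduced_representative)
  \<comment> \<open>As \<open>oct_width (n + 2)\<close> is twice \<open>oct_width n\<close>, halving
    the third bound on beta gives the coordinate bounds of octagon n. The bound on the sum is one
    weaker than that of the octagon; for odd X + Y parity closes this gap.\<close>
  have bounds: "\<bar>X\<bar> \<le> oct_width n - 2" "\<bar>Y\<bar> \<le> oct_width n - 2"
    "\<bar>X\<bar> + \<bar>Y\<bar> \<le> oct_width (Suc n) - 2"
    using red assms(2) unfolding octagon_def by (auto simp: max_def split: if_splits)
  have reach: "oct_tower n (X + (r' * a - s' * b)) (Y + (r' * b + s' * a)) \<Longrightarrow> 
     \<exists>r s. oct_tower n (x + (r * a - s * b)) (y + (r * b + s * a))" for r' s'
    by (rule exI[of _ "r + r'"], rule exI[of _ "s + s'"]) (simp add: XY algebra_simps)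
  show "\<exists>r s. oct_tower n (x + (r * a - s * b)) (y + (r * b + s * a))"
  proof (cases "oct_tower n X Y")
    case True
    then show ?thesis using XY by blast
  next
    case False
    have even: "even (X + Y)"
    proof (rule ccontr)
      assume odd: "odd (X + Y)"
      then have "odd (\<bar>X\<bar> + \<bar>Y\<bar>)" by simp
      then have "\<bar>X\<bar> + \<bar>Y\<bar> \<noteq> oct_width (Suc n) - 2"
        using even_oct_width_Suc[of n] by presburger
      then have "octagon n X Y" using bounds unfolding octagon_def by linarith
      then show False using False odd oct_tower_odd by blast
    qed
    have "shift_reaches n X Y a b"
      by (rule shift_into_octagon[OF False assms(1) even assms(2) bounds])
    then show ?thesis
      unfolding shift_reaches_def
    proof (elim disjE)
      assume "octagon n (X - a) (Y - b)"
      then have "oct_tower n (X - a) (Y - b)" using assms(1) even by (subst oct_tower_odd) auto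
      then show ?thesis by (intro reach[of "-1" 0]) simp
    next
      assume "octagon n (X + a) (Y + b)"
      then have "oct_tower n (X + a) (Y + b)" using assms(1) even by (subst oct_tower_odd) auto
      then show ?thesis by (intro reach[of 1 0]) simp
    next
      assume "octagon n (X - b) (Y + a)"
      then have "oct_tower n (X - b) (Y + a)" using assms(1) even by (subst oct_tower_odd) auto
      then show ?thesis by (intro reach[of 0 1]) simp
    next
      assume "octagon n (X + b) (Y - a)"
      then have "oct_tower n (X + b) (Y - a)" using assms(1) even by (subst oct_tower_odd) auto
      then show ?thesis by (intro reach[of 0 "-1"]) simp
    qed
  qed
qed

lemma unit_covers:
  fixes c d x y :: int
  assumes "\<bar>c\<bar> + \<bar>d\<bar> = 1"
  obtains r s where "x + (r * c - s * d) = 0" "y + (r * d + s * c) = 0"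
proof -
  have "c * c + d * d = 1"
  proof -
    have "c = 0 \<and> (d = 1 \<or> d = -1) \<or> d = 0 \<and> (c = 1 \<or> c = -1)" using assms by linarith
    then show ?thesis by auto
  qed
  \<comment> \<open>The witness r + si is -(x + yi) times the conjugate of the unit c + di.\<close>
  moreover have "x + ((- x * c - y * d) * c - (x * d - y * c) * d) = x * (1 - (c * c + d * d))"
    "y + ((- x * c - y * d) * d + (x * d - y * c) * c) = y * (1 - (c * c + d * d))"
    by (simp_all add: algebra_simps)
  ultimately show thesis by (intro that) auto
qed

text \<open>Every number is 0 or 1 plus a multiple (1 + i)(u + vi). A representative of u + vi
  modulo c + di, multiplied by 1 + i, therefore serves both parities, provided that adding 1 stays
  in the tower set.\<close>

lemma tower_covers_mult:
  assumes "\<And>x y. \<exists>r s p q. p = x + (r * c - s * d) \<and> q = y + (r * d + s * c) \<and>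
    oct_tower n (p - q) (p + q) \<and> oct_tower n (1 + (p - q)) (p + q)"
  shows "tower_covers n (c - d) (c + d)"
  unfolding tower_covers_def
proof (intro allI)
  fix x y :: int
  define e :: int where "e = (if even (x + y) then 0 else 1)"
  have "even (x - e + y)" by (auto simp: e_def)
  then obtain u v where uv: "x - e = u - v" "y = u + v" by (rule gauss_factor)
  obtain r s p q where pq: "p = u + (r * c - s * d)" "q = v + (r * d + s * c)"
    and tower: "oct_tower n (p - q) (p + q)" "oct_tower n (1 + (p - q)) (p + q)"
    using assms[of u v] by blast
  have "x + (r * (c - d) - s * (c + d)) = e + (p - q)"
    "y + (r * (c + d) + s * (c - d)) = p + q"
    using uv unfolding pq by (auto simp: algebra_simps)
  then show "\<exists>r s. oct_tower n (x + (r * (c - d) - s * (c + d))) (y + (r * (c + d) + s * (c - d)))"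
    using tower unfolding e_def by (intro exI[of _ r] exI[of _ s]) auto
qed

lemma oct_tower_covers:
  assumes "oct_tower (Suc n) a b" "a \<noteq> 0 \<or> b \<noteq> 0"
  shows "tower_covers n a b"
  using assms
proof (induction n arbitrary: a b)
  case 0
  show ?case
  proof (cases "even (a + b)")
    case True
    then obtain c d where ab: "a = c - d" "b = c + d" by (rule gauss_factor)
    have "octagon 0 c d" using 0(1) unfolding ab oct_tower_mult by simp
    \<comment> \<open>Here beta is a unit times 1 + i, so 0 and 1 represent all classes.\<close>
    then have "\<bar>c\<bar> + \<bar>d\<bar> = 1" using 0(2) unfolding ab octagon_def by auto
    show ?thesis
      unfolding ab
    proof (rule tower_covers_mult)
      fix x y :: int
      obtain r s where "x + (r * c - s * d) = 0" "y + (r * d + s * c) = 0"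
        by (rule unit_covers[OF \<open>\<bar>c\<bar> + \<bar>d\<bar> = 1\<close>])
      then show "\<exists>r s p q. p = x + (r * c - s * d) \<and> q = y + (r * d + s * c) \<and>
        oct_tower 0 (p - q) (p + q) \<and> oct_tower 0 (1 + (p - q)) (p + q)"
        by (intro exI[of _ r] exI[of _ s] exI[of _ 0]) (simp add: octagon_def)
    qed
  next
    case False
    then show ?thesis using 0 by (intro tower_covers_odd) auto
  qed
next
  case (Suc n)
  show ?case
  proof (cases "even (a + b)")
    case True
    then obtain c d where ab: "a = c - d" "b = c + d" by (rule gauss_factor)
    have "tower_covers n c d"
      using Suc unfolding ab oct_tower_mult by auto
    then show ?thesis
      unfolding ab tower_covers_def
      by (intro tower_covers_mult[unfolded tower_covers_def])
        (meson oct_tower_mult oct_tower_mult_add_1)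
  next
    case False
    then show ?thesis using Suc by (intro tower_covers_odd) auto
  qed
qed

section \<open>Moduli with all classes represented lie in the next tower set\<close>

text \<open>A unit factor only permutes the coordinates up to sign. Any other nonzero factor has
  norm at least 2, which makes up for the constant in (|a| + |b|)^2 <= 2 (a^2 + b^2).\<close>

lemma l1_norm_mult_ge:
  fixes a b g h :: int
  assumes "g \<noteq> 0 \<or> h \<noteq> 0"
  shows "\<bar>a\<bar> + \<bar>b\<bar> \<le> \<bar>a * g - b * h\<bar> + \<bar>a * h + b * g\<bar>"
proof (cases "\<bar>g\<bar> + \<bar>h\<bar> = 1")
  case True
  then have "g = 0 \<and> (h = 1 \<or> h = -1) \<or> h = 0 \<and> (g = 1 \<or> g = -1)" by linarith
  then show ?thesis by auto
next
  case False
  define X Y where "X = \<bar>a * g - b * h\<bar>" and "Y = \<bar>a * h + b * g\<bar>"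
  have "2 \<le> \<bar>g\<bar> + \<bar>h\<bar>" using assms False by linarith
  moreover have "\<bar>k\<bar> \<le> k\<^sup>2" for k :: int
    using mult_left_mono[of 1 "\<bar>k\<bar>" "\<bar>k\<bar>"] by (cases "k = 0") (auto simp: power2_eq_square)
  ultimately have gh: "2 \<le> g\<^sup>2 + h\<^sup>2" by (smt (verit))
  have "(\<bar>a\<bar> + \<bar>b\<bar>)\<^sup>2 + (\<bar>a\<bar> - \<bar>b\<bar>)\<^sup>2 = (a\<^sup>2 + b\<^sup>2) * 2"
    by (simp add: power2_eq_square algebra_simps)
  then have "(\<bar>a\<bar> + \<bar>b\<bar>)\<^sup>2 \<le> (a\<^sup>2 + b\<^sup>2) * 2"
    using zero_le_power2[of "\<bar>a\<bar> - \<bar>b\<bar>"] by linarith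
  also have "\<dots> \<le> (a\<^sup>2 + b\<^sup>2) * (g\<^sup>2 + h\<^sup>2)"
    using gh by (intro mult_left_mono) auto
  also have "\<dots> = X\<^sup>2 + Y\<^sup>2"
    unfolding X_def Y_def by (simp add: power2_eq_square algebra_simps)
  also have "\<dots> \<le> (X + Y)\<^sup>2"
    unfolding power2_sum by (simp add: X_def Y_def)
  finally have "\<bar>a\<bar> + \<bar>b\<bar> \<le> X + Y"
    by (rule power2_le_imp_le) (simp add: X_def Y_def)
  then show ?thesis by (simp add: X_def Y_def)
qed

text \<open>Multiplication by 1 + i turns twice the sup norm into the l1 norm, so the l1 estimate is
  applied to (1 + i)(a + bi).\<close>

lemma sup_norm_mult_ge:
  fixes a b g h :: int
  assumes "g \<noteq> 0 \<or> h \<noteq> 0"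
  shows "max \<bar>a\<bar> \<bar>b\<bar> \<le> max \<bar>a * g - b * h\<bar> \<bar>a * h + b * g\<bar>"
proof -
  define X Y where "X = a * g - b * h" and "Y = a * h + b * g"
  have "\<bar>a - b\<bar> + \<bar>a + b\<bar> \<le> \<bar>X - Y\<bar> + \<bar>X + Y\<bar>"
    using l1_norm_mult_ge[OF assms, of "a - b" "a + b"] by (simp add: X_def Y_def algebra_simps)
  then have "2 * max \<bar>a\<bar> \<bar>b\<bar> \<le> 2 * max \<bar>X\<bar> \<bar>Y\<bar>"
    unfolding sup_rotate by (simp only: add.commute)
  then show ?thesis unfolding X_def Y_def by (rule mult_left_le_imp_le) simp
qed

text \<open>For odd \<open>\<beta>\<close> the class of \<open>(\<beta> + 1) / (1 - i)\<close> forces \<open>\<beta>\<close> into the next octagon: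
  a representative \<open>l\<close> satisfies \<open>(1 - i) l = 1 + \<beta> \<gamma>\<close> with \<open>\<gamma> \<noteq> 0\<close>.\<close>

lemma tower_covers_imp_octagon:
  assumes "tower_covers n a b" "odd (a + b)"
  shows "octagon (Suc n) a b"
proof -
  obtain x y where xy: "a + 1 = x + y" "b = y - x"
  proof
    show "a + 1 = (a + 1 - b) div 2 + (a + 1 + b) div 2" "b = (a + 1 + b) div 2 - (a + 1 - b) div 2"
      using assms(2) by presburger+
  qed
  obtain r s where l: "oct_tower n (x + (r * a - s * b)) (y + (r * b + s * a))"
    using assms(1) unfolding tower_covers_def by blast
  define p q where "p = x + (r * a - s * b)" and "q = y + (r * b + s * a)"
  define g h where "g = 1 + r + s" and "h = s - r"
  define X Y where "X = a * g - b * h" and "Y = a * h + b * g"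
  \<comment> \<open>g + hi = 1 + (1 - i)(r + si) is not divisible by 1 - i.\<close>
  have "g \<noteq> 0 \<or> h \<noteq> 0" unfolding g_def h_def by presburger
  then have "\<bar>a\<bar> + \<bar>b\<bar> \<le> \<bar>X\<bar> + \<bar>Y\<bar>" "max \<bar>a\<bar> \<bar>b\<bar> \<le> max \<bar>X\<bar> \<bar>Y\<bar>"
    unfolding X_def Y_def by (rule l1_norm_mult_ge sup_norm_mult_ge)+
  \<comment> \<open>The summand 1 costs at most one in either norm, just what the next octagon
    allows.\<close>
  moreover have "p + q = 1 + X" "q - p = Y"
    using xy unfolding p_def q_def X_def Y_def g_def h_def by (auto simp: algebra_simps)
  moreover have "octagon n p q"
    using l oct_tower_imp_octagon unfolding p_def q_def by blast
  ultimately show ?thesis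
    unfolding octagon_def oct_width.simps by linarith
qed

lemma tower_covers_imp_oct_tower:
  assumes "tower_covers n a b"
  shows "oct_tower (Suc n) a b"
  using assms
proof (induction n arbitrary: a b)
  case 0
  show ?case
  proof (cases "even (a + b)")
    case True
    then obtain c d where ab: "a = c - d" "b = c + d" by (rule gauss_factor)
    \<comment> \<open>The class of 1 + i is tested: its representative is a multiple of 1 + i in
      octagon 0, hence 0, and this makes c + di a unit.\<close>
    obtain r s where "octagon 0 (1 + (r * a - s * b)) (1 + (r * b + s * a))"
      using 0 unfolding tower_covers_def by (metis oct_tower.simps(1))
    moreover define p q where "p = 1 + (r * c - s * d)" and "q = r * d + s * c"
    moreover have "1 + (r * a - s * b) = p - q" "1 + (r * b + s * a) = p + q"
      unfolding p_def q_def ab by (auto simp: algebra_simps)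
    ultimately have "octagon 0 (p - q) (p + q)" by simp
    then have "p = 0" "q = 0" by (auto simp: octagon_def)
    then have 1: "d * s - c * r = 1" "r * d + s * c = 0" by (auto simp: p_def q_def algebra_simps)
    have "r \<noteq> 0 \<or> s \<noteq> 0" using 1 by auto
    have "\<bar>c\<bar> + \<bar>d\<bar> \<le> \<bar>c * r - d * s\<bar> + \<bar>c * s + d * r\<bar>"
      by (rule l1_norm_mult_ge) fact
    also have "\<dots> = 1"
      using 1 by (simp add: algebra_simps)
    finally have "octagon 0 c d" by (auto simp: octagon_def)
    then show ?thesis unfolding ab oct_tower_mult by simp
  next
    case False
    then show ?thesis using 0 tower_covers_imp_octagon by auto
  qed
next
  case (Suc n)
  show ?case
  proof (cases "even (a + b)")
    case True
    then obtain c d where ab: "a = c - d" "b = c + d" by (rule gauss_factor)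
    have "tower_covers n c d"
      unfolding tower_covers_def
    proof (intro allI)
      fix x y
      \<comment> \<open>The class of (1 + i)(x + yi) modulo the even beta has only even members, so
        its representative can be divided by 1 + i.\<close>
      obtain r s where rs: "oct_tower (Suc n) (x - y + (r * a - s * b)) (x + y + (r * b + s * a))"
        using Suc.prems unfolding tower_covers_def by blast
      define p q where "p = x + (r * c - s * d)" and "q = y + (r * d + s * c)"
      have "x - y + (r * a - s * b) = p - q" "x + y + (r * b + s * a) = p + q"
        unfolding p_def q_def ab by (auto simp: algebra_simps)
      then show "\<exists>r s. oct_tower n (x + (r * c - s * d)) (y + (r * d + s * c))"
        using rs oct_tower_mult unfolding p_def q_def by metis
    qed
    then show ?thesis using Suc.IH unfolding ab oct_tower_mult by blast
  next
    case False
    then show ?thesis using Suc tower_covers_imp_octagon by auto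
  qed
qed

section \<open>Counting odd points in a truncated diamond\<close>

text \<open>The part of the diamond \<open>\<bar>x\<bar> + \<bar>y\<bar> \<le> m\<close> to the right of \<open>x = m - t\<close>; for \<open>t = m + 1\<close> and
  \<open>t = m\<close> this gives (up to reflection) the two halves of the diamond.\<close>

definition odd_corner :: "int \<Rightarrow> nat \<Rightarrow> (int \<times> int) set" where
  "odd_corner m t = {(x, y). m - int t < x \<and> x + \<bar>y\<bar> \<le> m \<and> odd (x + y)}"

text \<open>Each step adds the column x = m - t, where |y| <= t; as m is odd, y must have the parity
  of t, which leaves t + 1 points.\<close>

lemma card_odd_corner:
  assumes "odd m"
  shows "finite (odd_corner m t) \<and> 2 * card (odd_corner m t) = t * (t + 1)"
proof (induction t)
  case 0
  have "odd_corner m 0 = {}" by (auto simp: odd_corner_def)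
  then show ?case by simp
next
  case (Suc t)
  define f where "f i = (m - int t, 2 * int i - int t)" for i
  have inj: "inj_on f {..t}" by (auto simp: f_def inj_on_def)
  have "odd_corner m (Suc t) = odd_corner m t \<union> f ` {..t}"
  proof (intro equalityI subsetI)
    fix z assume z: "z \<in> odd_corner m (Suc t)"
    obtain x y where xy: "z = (x, y)" by fastforce
    show "z \<in> odd_corner m t \<union> f ` {..t}"
    proof (cases "x = m - int t")
      case True
      then have y: "\<bar>y\<bar> \<le> int t" "even (y + int t)"
        using z assms by (auto simp: xy odd_corner_def)
      then have "z = f (nat ((y + int t) div 2))" "nat ((y + int t) div 2) \<le> t"
        by (auto simp: f_def xy True)
      then show ?thesis by blast
    next
      case False
      then show ?thesis using z by (auto simp: xy odd_corner_def)
    qed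
  next
    fix z assume "z \<in> odd_corner m t \<union> f ` {..t}"
    then show "z \<in> odd_corner m (Suc t)"
      using assms by (auto simp: odd_corner_def f_def)
  qed
  moreover have "odd_corner m t \<inter> f ` {..t} = {}"
    by (auto simp: odd_corner_def f_def)
  ultimately have "finite (odd_corner m (Suc t))"
    "card (odd_corner m (Suc t)) = card (odd_corner m t) + (t + 1)"
    using Suc inj by (auto simp: card_Un_disjoint card_image)
  then show ?case using Suc by simp
qed

text \<open>The full diamond has (m + 1)^2 odd points, and four corners congruent to
  \<open>odd_corner m (m - s)\<close> are removed.\<close>

lemma card_odd_truncated_diamond:
  fixes s m :: int
  assumes "odd m" "0 \<le> s" "s \<le> m" "m \<le> 2 * s + 1"
  defines "S \<equiv> {(x, y). odd (x + y) \<and> \<bar>x\<bar> \<le> s \<and> \<bar>y\<bar> \<le> s \<and> \<bar>x\<bar> + \<bar>y\<bar> \<le> m}"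
  shows "finite S" "int (card S) = (m + 1)\<^sup>2 - 2 * (m - s) * (m - s + 1)"
proof -
  define neg where "neg = (\<lambda>(x, y). (- x, y) :: int \<times> int)"
  define C where "C = odd_corner m (nat (m - s))"
  have bij: "bij neg" "bij (prod.swap :: int \<times> int \<Rightarrow> _)"
    by (rule o_bij[of neg] o_bij[of prod.swap]; auto simp: neg_def fun_eq_iff)+
  note corner = card_odd_corner[OF assms(1)]
  have fin: "finite C" "finite (neg -` C)" "finite (prod.swap -` C)" "finite (prod.swap -` neg -` C)"
    using corner bij by (auto simp: C_def bij_def intro!: finite_vimageI)
  have cards: "card (neg -` A) = card A" "card (prod.swap -` A) = card A" for A :: "(int \<times> int) set"
    using bij by (auto intro!: card_vimage_inj simp: bij_def)
  define D where "D = odd_corner m (nat (m + 1)) \<union> neg -` odd_corner m (nat m)"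
  have D: "D = {(x, y). odd (x + y) \<and> \<bar>x\<bar> + \<bar>y\<bar> \<le> m}"
    using assms(2,3) unfolding D_def by (auto simp: odd_corner_def neg_def)
  have finD: "finite D" using corner bij by (auto simp: D_def bij_def intro!: finite_vimageI)
  have "odd_corner m (nat (m + 1)) \<inter> neg -` odd_corner m (nat m) = {}"
    using assms(2,3) by (auto simp: odd_corner_def neg_def)
  then have "2 * card D = nat (m + 1) * (nat (m + 1) + 1) + nat m * (nat m + 1)"
    using corner bij unfolding D_def by (simp add: card_Un_disjoint cards finite_vimageI bij_def)
  then have "2 * int (card D) = int (nat (m + 1) * (nat (m + 1) + 1) + nat m * (nat m + 1))"
    by linarith
  then have cardD: "int (card D) = (m + 1)\<^sup>2"
    using assms(2,3) by (simp add: power2_eq_square algebra_simps)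
  have C: "(x, y) \<in> C \<longleftrightarrow> s < x \<and> x + \<bar>y\<bar> \<le> m \<and> odd (x + y)" for x y
    using assms(3) by (auto simp: C_def odd_corner_def)
  define U where "U = (C \<union> neg -` C) \<union> (prod.swap -` C \<union> prod.swap -` neg -` C)"
  have DU: "D = S \<union> U" "S \<inter> U = {}"
    using assms(2) by (auto simp: D S_def U_def neg_def C add.commute)
  \<comment> \<open>Corners on different axes are disjoint: two absolute values above s would sum to
    at least 2s + 2 > m.\<close>
  have disj: "C \<inter> neg -` C = {}" "prod.swap -` C \<inter> prod.swap -` neg -` C = {}"
    "(C \<union> neg -` C) \<inter> (prod.swap -` C \<union> prod.swap -` neg -` C) = {}"
    using assms(2,4) by (auto simp: neg_def C)
  have "card U = 4 * card C"
    using fin disj unfolding U_def by (simp add: card_Un_disjoint cards)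
  then have "card U = 2 * (nat (m - s) * (nat (m - s) + 1))"
    using corner[of "nat (m - s)"] by (simp add: C_def)
  then have cardU: "int (card U) = 2 * (m - s) * (m - s + 1)"
    using assms(3) by (simp add: algebra_simps)
  show "finite S" using finD DU by simp
  moreover have "finite U" using finD DU by simp
  ultimately have "card D = card S + card U"
    using DU by (simp add: card_Un_disjoint)
  then show "int (card S) = (m + 1)\<^sup>2 - 2 * (m - s) * (m - s + 1)"
    using cardD cardU by simp
qed

section \<open>Transfer to the Motzkin sets and the final count\<close>

definition gauss :: "int \<times> int \<Rightarrow> complex" where
  "gauss = (\<lambda>(a, b). Complex (of_int a) (of_int b))"

definition tower_set :: "nat \<Rightarrow> (int \<times> int) set" where
  "tower_set n = {(a, b). oct_tower n a b}"

lemma inj_gauss: "inj gauss"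
  by (auto simp: gauss_def inj_def)

lemma gauss_ints_eq: "gauss_ints = range gauss"
proof (intro equalityI subsetI)
  fix z assume "z \<in> gauss_ints"
  then obtain a b where "Re z = of_int a" "Im z = of_int b"
    by (auto simp: gauss_ints_def Ints_def)
  then have "z = gauss (a, b)" by (simp add: gauss_def complex_eq_iff)
  then show "z \<in> range gauss" by blast
qed (auto simp: gauss_ints_def gauss_def)

lemma gauss_add_mult:
  "gauss (x, y) + gauss (r, s) * gauss (a, b) = gauss (x + (r * a - s * b), y + (r * b + s * a))"
  by (simp add: gauss_def complex_eq_iff)

lemma represents_gauss:
  "represents_all_classes (gauss ` tower_set n) (gauss (a, b)) \<longleftrightarrow> tower_covers n a b"
proof -
  have "(\<exists>m \<in> gauss ` tower_set n. m \<in> residue_class (gauss (a, b)) (gauss (x, y))) \<longleftrightarrow>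
    (\<exists>r s. oct_tower n (x + (r * a - s * b)) (y + (r * b + s * a)))" for x y
  proof -
    have "residue_class (gauss (a, b)) (gauss (x, y)) =
      {gauss (x + (r * a - s * b), y + (r * b + s * a)) | r s. True}"
      unfolding residue_class_def gauss_ints_eq by (force simp flip: gauss_add_mult)
    then show ?thesis
      using inj_gauss by (force simp: tower_set_def inj_eq)
  qed
  then show ?thesis
    unfolding represents_all_classes_def gauss_ints_eq tower_covers_def by simp
qed

text \<open>The two covering results give the induction step. Zero, which
  \<open>oct_tower_covers\<close> leaves out, already belongs to the preceding set.\<close>

lemma motzkin_eq: "motzkin n = gauss ` tower_set n"
proof (induction n)
  case 0
  have "tower_set 0 = {(0, 0), (1, 0), (-1, 0), (0, 1), (0, -1)}"
    by (auto simp: tower_set_def octagon_def)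
  then show ?case by (auto simp: gauss_def complex_eq_iff)
next
  case (Suc n)
  have "oct_tower (Suc n) a b \<longleftrightarrow> oct_tower n a b \<or> tower_covers n a b" for a b
    using oct_tower_mono oct_tower_covers tower_covers_imp_oct_tower oct_tower_0 by blast
  then have "tower_set (Suc n) = tower_set n \<union> {(a, b). tower_covers n a b}"
    by (auto simp: tower_set_def)
  moreover have "{\<beta> \<in> gauss_ints. represents_all_classes (gauss ` tower_set n) \<beta>} =
    gauss ` {(a, b). tower_covers n a b}"
    by (auto simp: gauss_ints_eq represents_gauss)
  ultimately show ?case using Suc by (simp add: image_Un)
qed

lemma min_euclid_fibre:
  "min_euclid -` {Suc n} \<inter> (gauss_ints - {0}) = gauss ` (tower_set (Suc n) - tower_set n)"
proof (intro equalityI subsetI)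
  fix z assume z: "z \<in> min_euclid -` {Suc n} \<inter> (gauss_ints - {0})"
  then obtain a b where ab: "z = gauss (a, b)" by (auto simp: gauss_ints_eq)
  obtain k where "z \<in> motzkin k"
    using oct_tower_exhausts[of a b] by (auto simp: ab motzkin_eq tower_set_def)
  then have "z \<in> motzkin (min_euclid z)"
    unfolding min_euclid_def by (rule LeastI)
  moreover have "z \<notin> motzkin n"
    using z not_less_Least[of n "\<lambda>j. z \<in> motzkin j"] by (simp add: min_euclid_def)
  ultimately show "z \<in> gauss ` (tower_set (Suc n) - tower_set n)"
    using z inj_gauss by (simp add: motzkin_eq image_set_diff)
next
  fix z assume "z \<in> gauss ` (tower_set (Suc n) - tower_set n)"
  then have z: "z \<in> motzkin (Suc n)" "z \<notin> motzkin n"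
    using inj_gauss by (simp_all add: motzkin_eq image_set_diff)
  have "mono motzkin" by (rule mono_iff_le_Suc[THEN iffD2]) auto
  have "min_euclid z = Suc n"
    unfolding min_euclid_def
  proof (rule Least_equality)
    fix j assume "z \<in> motzkin j"
    then show "Suc n \<le> j"
      using z(2) monoD[OF \<open>mono motzkin\<close>, of j n] by (meson not_less_eq_eq subsetD)
  qed fact
  moreover have "0 \<in> motzkin n"
    using monoD[OF \<open>mono motzkin\<close>, of 0 n] by auto
  ultimately show "z \<in> min_euclid -` {Suc n} \<inter> (gauss_ints - {0})"
    using z by (auto simp: motzkin_eq gauss_ints_eq)
qed

text \<open>The even part of the new tower set is 1 + i times the old one and has the same size.
  Hence the fibre has as many elements as the odd part S, although it is in general a different
  set.\<close>

lemma card_min_euclid_fibre: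
  fixes n :: nat
  defines "s \<equiv> oct_width (Suc n) - 2" and "m \<equiv> oct_width (Suc (Suc n)) - 3"
  shows "int (card (min_euclid -` {Suc n} \<inter> (gauss_ints - {0})))
    = (m + 1)\<^sup>2 - 2 * (m - s) * (m - s + 1)"
proof -
  define mul :: "int \<times> int \<Rightarrow> int \<times> int" where "mul = (\<lambda>(c, d). (c - d, c + d))"
  define S where "S = {(x, y). odd (x + y) \<and> \<bar>x\<bar> \<le> s \<and> \<bar>y\<bar> \<le> s \<and> \<bar>x\<bar> + \<bar>y\<bar> \<le> m}"
  have inj: "inj mul" by (auto simp: mul_def inj_def)
  have "oct_tower (Suc n) a b \<longleftrightarrow> (a, b) \<in> S \<or> (a, b) \<in> mul ` tower_set n" for a b
  proof (cases "even (a + b)")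
    case True
    then obtain c d where ab: "a = c - d" "b = c + d" by (rule gauss_factor)
    have "(a, b) = mul (c, d)" by (simp add: ab mul_def)
    then have "(a, b) \<in> mul ` tower_set n \<longleftrightarrow> oct_tower n c d"
      using inj by (simp add: inj_image_mem_iff tower_set_def)
    moreover have "(a, b) \<notin> S" using True by (simp add: S_def)
    ultimately show ?thesis unfolding ab oct_tower_mult by blast
  next
    case False
    then have "(a, b) \<notin> mul ` tower_set n" by (auto simp: mul_def)
    then show ?thesis using False by (simp add: S_def s_def m_def octagon_def)
  qed
  then have step: "tower_set (Suc n) = S \<union> mul ` tower_set n"
    by (auto simp: tower_set_def)
  have fin: "finite (tower_set k)" for k
  proof (rule finite_subset)
    show "tower_set k \<subseteq> {- oct_width k..oct_width k} \<times> {- oct_width k..oct_width k}"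
      by (auto simp: tower_set_def octagon_def dest!: oct_tower_imp_octagon)
  qed simp
  have S: "int (card S) = (m + 1)\<^sup>2 - 2 * (m - s) * (m - s + 1)"
    unfolding S_def
    using oct_width_growth[of "Suc n"] oct_width_ge[of "Suc n"] even_oct_width_Suc[of "Suc n"]
      even_oct_width_Suc[of n]
    by (intro card_odd_truncated_diamond) (auto simp: s_def m_def)
  have "S \<inter> mul ` tower_set n = {}" by (auto simp: S_def mul_def)
  moreover have "finite S" using fin[of "Suc n"] step by simp
  ultimately have "card (tower_set (Suc n)) = card S + card (tower_set n)"
    using fin[of n] inj_on_subset[OF inj subset_UNIV] unfolding step
    by (simp add: card_Un_disjoint card_image)
  moreover have "tower_set n \<subseteq> tower_set (Suc n)"
    using oct_tower_mono unfolding tower_set_def by blast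
  ultimately have "card (tower_set (Suc n) - tower_set n) = card S"
    using fin by (simp add: card_Diff_subset)
  then show ?thesis
    using S inj_on_subset[OF inj_gauss subset_UNIV] by (simp add: min_euclid_fibre card_image)
qed

lemma oct_width_even_odd: "oct_width (2 * k) = 3 * 2 ^ k" "oct_width (2 * k + 1) = 4 * 2 ^ k"
  by (induction k) auto

theorem theorem1p4:
  fixes k :: nat
  assumes "k \<ge> 1"
  shows "int (card (min_euclid -` {2 * k} \<inter> (gauss_ints - {0}))) = 14 * 4 ^ k - 14 * 2 ^ k + 4
       \<and> int (card (min_euclid -` {2 * k + 1} \<inter> (gauss_ints - {0}))) = 28 * 4 ^ k - 20 * 2 ^ k + 4"
proof -
  obtain n where n: "2 * k = Suc n" using assms by (cases k) auto
  define K :: int where "K = 2 ^ k"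
  have K: "(4 :: int) ^ k = K * K" "(2 :: int) ^ k = K"
    by (simp_all add: K_def flip: power_mult_distrib)
  \<comment> \<open>This gives s = 3K - 2, m = 4K - 3 at index 2k, and s = 4K - 2, m = 6K - 3 at
    index 2k + 1.\<close>
  have w: "oct_width (Suc n) = 3 * K" "oct_width (Suc (Suc n)) = 4 * K"
    "oct_width (2 * k) = 3 * K" "oct_width (Suc (2 * k)) = 4 * K" "oct_width (Suc (Suc (2 * k))) = 6 * K"
    using oct_width_even_odd[of k] by (simp_all add: K_def flip: n)
  have "int (card (min_euclid -` {2 * k} \<inter> (gauss_ints - {0}))) = 14 * 4 ^ k - 14 * 2 ^ k + 4"
    unfolding n card_min_euclid_fibre w K by (simp add: power2_eq_square algebra_simps)
  moreover have "int (card (min_euclid -` {2 * k + 1} \<inter> (gauss_ints - {0}))) = 28 * 4 ^ k - 20 * 2 ^ k + 4"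
    unfolding Suc_eq_plus1[symmetric] card_min_euclid_fibre w K
    by (simp add: power2_eq_square algebra_simps)
  ultimately show ?thesis by blast
qed

end
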